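(* Let $G$ be a connected graph of order $n\ge 2$ and let $\mathcal{H}=\{H_1,\dots,H_n\}$ be a family of $n$ non-trivial graphs such that for every $H_i\in\mathcal{H}$ the graph $K_1+H_i$ is $k_i$-metric dimensional. If $k'=\min_{i\in\{1,\dots,n\}}\{k_i\}$, then for any $k\in\{1,\dots,k'\}$, $$\dim_k(G\odot\mathcal{H})\le\sum_{i=1}^{n}\left(\dim_k(K_1+H_i)-f(H_i,k)\right).$$
   Context: All graphs are finite, simple and undirected; a graph is non-trivial if it has at least two vertices. $K_1+H$ is the join graph: $H$ together with one new vertex (the vertex of $K_1$) adjacent to every vertex of $H$. For a connected graph $\Gamma$, $d_\Gamma(x,y)$ is the length of a shortest path between $x$ and $y$. For a positive integer $k$, a set $S\subseteq V(\Gamma)$ is a $k$-metric generator for $\Gamma$ if for any two different vertices $u,v$ of $\Gamma$ there are at least $k$ vertices $w\in S$ with $d_\Gamma(u,w)\neq d_\Gamma(v,w)$. A $k$-metric basis is a $k$-metric generator of minimum cardinality, and its cardinality is the $k$-metric dimension $\dim_k(\Gamma)$. A connected graph is $k'$-metric dimensional if $k'$ is the largest integer for which a $k'$-metric basis exists. Corona product: if $G$ has vertices $v_1,\dots,v_n$ and $\mathcal{H}=\{H_1,\dots,H_n\}$ is a family of $n$ graphs (repetitions up to isomorphism allowed), $G\odot\mathcal{H}$ is obtained from the disjoint union of $G$ and $H_1,\dots,H_n$ by joining, for each $i$, the vertex $v_i$ by an edge to every vertex of $H_i$. If $K_1+H$ is $k'$-metric dimensional and $k\in\{1,\dots,k'\}$,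 then $f(H,k)=0$ if the vertex of $K_1$ does not belong to any $k$-metric basis of $K_1+H$, and $f(H,k)=1$ if there exists a $k$-metric basis of $K_1+H$ containing the vertex of $K_1$. *)

theory Defs
  imports "Graph_Theory.Graph_Theory"
begin

text \<open>Finite simple undirected graphs are the \<^locale>\<open>pair_graph\<close>s: finitely many vertices,
  a symmetric loop-free set of arcs, each edge being a pair of opposite arcs.\<close>

definition gdist :: "'a pair_pre_digraph \<Rightarrow> 'a \<Rightarrow> 'a \<Rightarrow> ereal" where
  "gdist G u v = wf_digraph.\<mu> (with_proj G) (\<lambda>_. 1) u v"

lemma gdist_shortest_path:
  assumes "pair_graph G" "connected (with_proj G)" "u \<in> pverts G" "v \<in> pverts G"
  obtains p where "pre_digraph.apath (with_proj G) u p v"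
    and "gdist G u v = ereal (real (length p))"
    and "\<And>q. pre_digraph.apath (with_proj G) u q v \<Longrightarrow> length p \<le> length q"
proof -
  interpret pair_graph G by fact
  have cost: "awalk_cost (\<lambda>_. 1) p = real (length p)" for p :: "('a \<times> 'a) list"
    by (induction p) auto
  have "strongly_connected (with_proj G)"
    using sym_arcs assms(2) by (rule symmetric_connected_imp_strongly_connected)
  then have "u \<rightarrow>\<^sup>*\<^bsub>with_proj G\<^esub> v"
    using assms(3,4) by (simp add: strongly_connected_def)
  then obtain p where p: "apath u p v" "\<mu> (\<lambda>_. 1) u v = ereal (awalk_cost (\<lambda>_. 1) p)"
    using min_cost_awalk[of u v "\<lambda>_. 1"] by auto
  show thesis
  proof (rule that[OF p(1)])
    show "gdist G u v = ereal (real (length p))"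
      using p(2) by (simp add: gdist_def cost)
    show "length p \<le> length q" if "apath u q v" for q
      using min_cost_le_walk_cost[OF awalkI_apath[OF that], of "\<lambda>_. 1"] p(2) by (simp add: cost)
  qed
qed

definition metric_generator :: "nat \<Rightarrow> 'a pair_pre_digraph \<Rightarrow> 'a set \<Rightarrow> bool" where
  "metric_generator k G S \<longleftrightarrow> S \<subseteq> pverts G \<and>
     (\<forall>u\<in>pverts G. \<forall>v\<in>pverts G. u \<noteq> v \<longrightarrow>
        k \<le> card {w \<in> S. gdist G u w \<noteq> gdist G v w})"

definition metric_basis :: "nat \<Rightarrow> 'a pair_pre_digraph \<Rightarrow> 'a set \<Rightarrow> bool" where
  "metric_basis k G S \<longleftrightarrow> metric_generator k G S \<and>
     (\<forall>T. metric_generator k G T \<longrightarrow> card S \<le> card T)"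

text \<open>Unspecified if there is no \<open>k\<close>-metric basis.\<close>

definition metric_dim :: "nat \<Rightarrow> 'a pair_pre_digraph \<Rightarrow> nat" where
  "metric_dim k G = (THE d. \<exists>S. metric_basis k G S \<and> card S = d)"

definition metric_dimensional :: "nat \<Rightarrow> 'a pair_pre_digraph \<Rightarrow> bool" where
  "metric_dimensional k' G \<longleftrightarrow> 1 \<le> k' \<and> (\<exists>S. metric_basis k' G S) \<and>
     (\<forall>k\<ge>1. (\<exists>S. metric_basis k G S) \<longrightarrow> k \<le> k')"

text \<open>The join \<open>K\<^sub>1 + H\<close>; the vertex of \<open>K\<^sub>1\<close> is \<^term>\<open>None\<close>.\<close>

definition K1_join :: "'b pair_pre_digraph \<Rightarrow> 'b option pair_pre_digraph" where
  "K1_join H = \<lparr> pverts = insert None (Some ` pverts H),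
     parcs = {(Some x, Some y) | x y. (x, y) \<in> parcs H}
       \<union> {(None, Some x) | x. x \<in> pverts H}
       \<union> {(Some x, None) | x. x \<in> pverts H} \<rparr>"

text \<open>The corona product, with the family indexed by the vertices of \<open>G\<close>: the vertex
  \<open>Inr (v, x)\<close> is the vertex \<open>x\<close> of the copy of \<open>H v\<close> joined to \<open>v\<close>.\<close>

definition corona ::
  "'a pair_pre_digraph \<Rightarrow> ('a \<Rightarrow> 'b pair_pre_digraph) \<Rightarrow> ('a + 'a \<times> 'b) pair_pre_digraph" where
  "corona G H = \<lparr> pverts = Inl ` pverts G \<union> Inr ` (SIGMA v:pverts G. pverts (H v)),
     parcs = {(Inl u, Inl v) | u v. (u, v) \<in> parcs G}
       \<union> {(Inr (v, x), Inr (v, y)) | v x y. v \<in> pverts G \<and> (x, y) \<in> parcs (H v)}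
       \<union> {(Inl v, Inr (v, x)) | v x. v \<in> pverts G \<and> x \<in> pverts (H v)}
       \<union> {(Inr (v, x), Inl v) | v x. v \<in> pverts G \<and> x \<in> pverts (H v)} \<rparr>"

definition basis_apex :: "'b pair_pre_digraph \<Rightarrow> nat \<Rightarrow> nat" where
  "basis_apex H k = (if \<exists>S. metric_basis k (K1_join H) S \<and> None \<in> S then 1 else 0)"

lemma pair_graph_iff:
  "pair_graph G \<longleftrightarrow> finite (pverts G) \<and>
     (\<forall>u v. (u, v) \<in> parcs G \<longrightarrow> u \<in> pverts G \<and> v \<in> pverts G \<and> u \<noteq> v \<and> (v, u) \<in> parcs G)"
  (is "?L \<longleftrightarrow> ?R")
proof
  assume ?L
  then interpret pair_graph G .
  show ?R
    by (intro conjI allI impI) (fact pair_finite_verts | erule in_arcsD1 in_arcsD2 no_loops' arcs_symmetric)+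
next
  assume R: ?R
  then have arcs: "fst e \<in> pverts G" "snd e \<in> pverts G" "fst e \<noteq> snd e" if "e \<in> parcs G" for e
    using that by (cases e; simp)+
  then have "parcs G \<subseteq> pverts G \<times> pverts G"
    by (simp add: subset_iff mem_Times_iff)
  then have fin: "finite (parcs G)"
    using R finite_subset by blast
  have "sym (parcs G)"
    using R by (simp add: sym_def)
  then have "symmetric (with_proj G)"
    by (simp add: symmetric_def)
  with R arcs fin show ?L
    by unfold_locales simp_all
qed

lemma pair_graph_K1_join:
  assumes "pair_graph H"
  shows "pair_graph (K1_join H)"
proof -
  have arc: "x \<in> pverts H \<and> y \<in> pverts H \<and> x \<noteq> y \<and> (y, x) \<in> parcs H"
    if "(x, y) \<in> parcs H" for x y
    using assms that unfolding pair_graph_iff by blast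
  have "finite (pverts (K1_join H))"
    using assms unfolding pair_graph_iff by (simp add: K1_join_def)
  then show ?thesis
    unfolding pair_graph_iff K1_join_def by (auto dest: arc)
qed

lemma pair_graph_corona:
  assumes "pair_graph G" and H: "\<And>v. v \<in> pverts G \<Longrightarrow> pair_graph (H v)"
  shows "pair_graph (corona G H)"
proof -
  have arcG: "x \<in> pverts G \<and> y \<in> pverts G \<and> x \<noteq> y \<and> (y, x) \<in> parcs G"
    if "(x, y) \<in> parcs G" for x y
    using assms(1) that unfolding pair_graph_iff by blast
  have arcH: "x \<in> pverts (H v) \<and> y \<in> pverts (H v) \<and> x \<noteq> y \<and> (y, x) \<in> parcs (H v)"
    if "(x, y) \<in> parcs (H v)" "v \<in> pverts G" for v x y
    using H[OF that(2)] that(1) unfolding pair_graph_iff by blast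
  have "finite (pverts (corona G H))"
    using assms unfolding pair_graph_iff by (simp add: corona_def)
  then show ?thesis
    unfolding pair_graph_iff corona_def by (auto dest: arcG arcH)
qed

end

theory Submission
  imports Defs
begin

text \<open>
  Write \<open>V\<close> for the vertex set of \<open>G\<close>.  For each \<open>v \<in> V\<close> choose a \<open>k\<close>-metric basis of \<open>K\<^sub>1 + H\<^sub>v\<close>, one through
  the apex whenever there is such a basis, and delete the apex from it.  The remaining sets
  \<open>B\<^sub>v \<subseteq> V(H\<^sub>v)\<close> have exactly the sizes that are summed on the right-hand side, so it suffices that
  the union \<open>S\<close> of their copies is a \<open>k\<close>-metric generator of the corona (\<open>metric_generator_corona\<close>).

  Two vertices of the same \<open>H\<^sub>v\<close> have the apex as a common neighbour, both in \<open>K\<^sub>1 + H\<^sub>v\<close> and in the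
  corona.  Their distance is therefore decided by equality and adjacency alone, and agrees in the two
  graphs (\<open>gdist_common_neighbour\<close>, \<open>gdist_corona_copy\<close>).  As the apex is at distance 1 from all of
  them, it separates no such pair; so \<open>B\<^sub>v\<close> separates each pair of vertices of \<open>H\<^sub>v\<close> in the corona by
  at least \<open>k\<close> of its elements.  Since \<open>H\<^sub>v\<close> is non-trivial, it also follows that
  \<open>k \<le> |B\<^sub>v|\<close> (\<open>card_generator_without_apex\<close>).

  Any other pair is separated by every element of \<open>B\<^sub>u\<close> for a suitable \<open>u\<close>.  The reason is that
  the copy of \<open>H\<^sub>v\<close> can be left only through \<open>v\<close>, so its vertices are farther than \<open>v\<close> from everything
  outside (\<open>gdist_gate_less\<close>).  A vertex of the copy of \<open>H\<^sub>v\<close> is thus separated from \<open>v\<close> by every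
  \<open>B\<^sub>u\<close> with \<open>u \<noteq> v\<close>, and such a \<open>u\<close> exists because \<open>G\<close> has at least two vertices.  Two
  vertices belonging to different blocks \<open>u\<close> and \<open>v\<close> are separated by \<open>B\<^sub>u\<close> or by \<open>B\<^sub>v\<close>: a copied
  vertex is within distance 2 of its own block, \<open>u\<close> itself is at distance 1 from \<open>B\<^sub>u\<close>, whereas
  \<open>B\<^sub>u\<close> is at distance at least 2 from \<open>v\<close> and at least 3 from the copy of \<open>H\<^sub>v\<close>.
\<close>

section \<open>Distances in graphs\<close>

context pair_graph
begin

lemma awalk_cost_unit: "awalk_cost (\<lambda>_. 1) p = real (length p)"
  by (induction p) auto

lemma gdist_eq_INF: "gdist G u v = (INF p\<in>{p. awalk u p v}. ereal (real (length p)))"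
  by (simp add: gdist_def \<mu>_def awalk_cost_unit)

lemma gdist_le_length: "awalk u p v \<Longrightarrow> gdist G u v \<le> ereal (real (length p))"
  unfolding gdist_eq_INF by (rule INF_lower) simp

lemma gdist_shortest_awalk:
  assumes "u \<rightarrow>\<^sup>*\<^bsub>with_proj G\<^esub> v"
  obtains p where "awalk u p v" and "gdist G u v = ereal (real (length p))"
proof -
  obtain p where "apath u p v" "\<mu> (\<lambda>_. 1) u v = ereal (awalk_cost (\<lambda>_. 1) p)"
    using assms min_cost_awalk[of u v "\<lambda>_. 1"] by auto
  then show thesis
    using that awalkI_apath by (auto simp: gdist_def awalk_cost_unit)
qed

lemma gdist_same:
  assumes "u \<in> pverts G"
  shows "gdist G u u = 0"
proof (rule antisym)
  show "gdist G u u \<le> 0"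
    using gdist_le_length[of u "[]" u] assms by (simp add: awalk_Nil_iff zero_ereal_def)
  show "0 \<le> gdist G u u"
    unfolding gdist_eq_INF by (rule INF_greatest) simp
qed

lemma gdist_arc:
  assumes "(u, v) \<in> parcs G"
  shows "gdist G u v = 1"
proof (rule antisym)
  show "gdist G u v \<le> 1"
    using gdist_le_length[of u "[(u, v)]" v] assms
    by (auto simp: awalk_Cons_iff awalk_Nil_iff one_ereal_def dest: in_arcsD2)
  have "1 \<le> length p" if "awalk u p v" for p
    using that no_loops'[OF assms] by (cases p) (auto simp: awalk_Nil_iff)
  then show "1 \<le> gdist G u v"
    unfolding gdist_eq_INF by (intro INF_greatest) (auto simp: one_ereal_def)
qed

lemma gdist_nonadjacent_ge:
  assumes "u \<noteq> v" and "(u, v) \<notin> parcs G"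
  shows "2 \<le> gdist G u v"
proof -
  have "2 \<le> length p" if "awalk u p v" for p
  proof (cases p)
    case Nil
    then show ?thesis
      using that assms by (simp add: awalk_Nil_iff)
  next
    case (Cons e q)
    then have "q \<noteq> []"
      using that assms by (cases e) (auto simp: awalk_Cons_iff awalk_Nil_iff)
    with Cons show ?thesis
      by (cases q) auto
  qed
  then show ?thesis
    unfolding gdist_eq_INF by (intro INF_greatest) (auto simp: numeral_eq_ereal)
qed

lemma gdist_common_neighbour:
  assumes "(u, c) \<in> parcs G" and "(c, v) \<in> parcs G"
  shows "gdist G u v = (if u = v then 0 else if (u, v) \<in> parcs G then 1 else 2)"
proof -
  have "awalk u [(u, c), (c, v)] v"
    using assms by (auto simp: awalk_Cons_iff awalk_Nil_iff dest: in_arcsD2)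
  then have "gdist G u v \<le> 2"
    using gdist_le_length by (force simp: numeral_eq_ereal)
  then show ?thesis
    using gdist_same gdist_arc gdist_nonadjacent_ge assms(1) in_arcsD1
    by (auto intro: antisym)
qed

text \<open>A walk from \<open>B\<close> to \<open>w\<close> must pass through the gate \<open>c\<close>, and its part after the gate is strictly
  shorter.  Reachability matters: if \<open>w\<close> were out of reach, both distances would be infinite.\<close>

lemma gdist_gate_less:
  assumes gate: "\<And>y z. (y, z) \<in> parcs G \<Longrightarrow> y \<in> B \<Longrightarrow> z \<in> B \<or> z = c"
    and "x \<in> B" and "w \<notin> B" and "x \<rightarrow>\<^sup>*\<^bsub>with_proj G\<^esub> w"
  shows "gdist G c w < gdist G x w"
proof -
  have suffix: "\<exists>q. awalk c q w \<and> length q < length p" if "awalk y p w" "y \<in> B" for p y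
    using that
  proof (induction p arbitrary: y)
    case Nil
    then show ?case
      using \<open>w \<notin> B\<close> by (simp add: awalk_Nil_iff)
  next
    case (Cons e p)
    then have e: "e \<in> parcs G" "fst e = y" and p: "awalk (snd e) p w"
      by (auto simp: awalk_Cons_iff)
    then have "snd e \<in> B \<or> snd e = c"
      using gate[of y "snd e"] Cons.prems(2) by (cases e) auto
    then show ?case
      using Cons.IH[OF p] p by (auto intro: less_SucI)
  qed
  obtain p where p: "awalk x p w" "gdist G x w = ereal (real (length p))"
    using assms(4) gdist_shortest_awalk by blast
  then obtain q where "awalk c q w" "length q < length p"
    using suffix \<open>x \<in> B\<close> by blast
  then show ?thesis
    using gdist_le_length[of c q w] p(2) by (simp add: order.strict_trans1)
qed

end

section \<open>Metric generators and bases\<close>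

lemma metric_basis_exists:
  assumes "metric_generator k G S"
  obtains B where "metric_basis k G B"
  using assms ex_has_least_nat[of "metric_generator k G" S card]
  unfolding metric_basis_def by blast

lemma metric_dim_eq_card:
  assumes "metric_basis k G B"
  shows "metric_dim k G = card B"
  unfolding metric_dim_def using assms
  by (intro the_equality) (auto simp: metric_basis_def intro: antisym)

lemma metric_dim_le_card:
  assumes "metric_generator k G S"
  shows "metric_dim k G \<le> card S"
  using assms metric_basis_exists metric_dim_eq_card by (metis metric_basis_def)

lemma metric_generator_antimono:
  assumes "metric_generator k G S" and "j \<le> k"
  shows "metric_generator j G S"
  using assms unfolding metric_generator_def by (meson order.trans)

section \<open>Joins with a single vertex\<close>

lemma gdist_K1_join:
  assumes "pair_graph H" and "x \<in> pverts H" and "y \<in> pverts H"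
  shows "gdist (K1_join H) (Some x) (Some y) =
    (if x = y then 0 else if (x, y) \<in> parcs H then 1 else 2)"
proof -
  interpret J: pair_graph "K1_join H"
    using assms(1) by (rule pair_graph_K1_join)
  have "(Some x, None) \<in> parcs (K1_join H)" "(None, Some y) \<in> parcs (K1_join H)"
    using assms by (auto simp: K1_join_def)
  moreover have "(Some x, Some y) \<in> parcs (K1_join H) \<longleftrightarrow> (x, y) \<in> parcs H"
    by (auto simp: K1_join_def)
  ultimately show ?thesis
    by (simp add: J.gdist_common_neighbour)
qed

lemma gdist_K1_join_apex:
  assumes "pair_graph H" and "x \<in> pverts H"
  shows "gdist (K1_join H) (Some x) None = 1"
proof -
  interpret J: pair_graph "K1_join H"
    using assms(1) by (rule pair_graph_K1_join)
  show ?thesis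
    using assms by (intro J.gdist_arc) (auto simp: K1_join_def)
qed

lemma vimage_Some_generator_subset:
  assumes "metric_generator k (K1_join H) B"
  shows "Some -` B \<subseteq> pverts H"
  using assms by (auto simp: metric_generator_def K1_join_def)

text \<open>The apex is at the same distance from all vertices of \<open>H\<close>, so it contributes nothing to the
  separation of two of them.\<close>

lemma card_separators_without_apex:
  assumes "pair_graph H" and gen: "metric_generator k (K1_join H) B"
    and "x \<in> pverts H" and "y \<in> pverts H" and "x \<noteq> y"
  shows "k \<le> card {z \<in> Some -` B.
    gdist (K1_join H) (Some x) (Some z) \<noteq> gdist (K1_join H) (Some y) (Some z)}" (is "_ \<le> card ?Z")
proof -
  have "Some x \<in> pverts (K1_join H)" "Some y \<in> pverts (K1_join H)"
    using assms(3,4) by (simp_all add: K1_join_def)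
  then have "k \<le> card {w \<in> B. gdist (K1_join H) (Some x) w \<noteq> gdist (K1_join H) (Some y) w}"
    (is "_ \<le> card ?W")
    using gen \<open>x \<noteq> y\<close> by (simp add: metric_generator_def)
  also have "?W = Some ` ?Z"
  proof -
    have "w \<noteq> None" if "w \<in> ?W" for w
      using that assms(3,4) gdist_K1_join_apex[OF assms(1)] by (cases w) auto
    then show ?thesis
      by (auto simp: image_iff not_None_eq)
  qed
  also have "card (Some ` ?Z) = card ?Z"
    by (simp add: card_image)
  finally show ?thesis .
qed

lemma card_generator_without_apex:
  assumes "pair_graph H" and "2 \<le> card (pverts H)" and "metric_generator k (K1_join H) B"
  shows "k \<le> card (Some -` B)"
proof -
  obtain x y where "x \<in> pverts H" "y \<in> pverts H" "x \<noteq> y"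
    using assms(2) by (auto simp: numeral_2_eq_2 card_le_Suc_iff)
  then have "k \<le> card {z \<in> Some -` B.
      gdist (K1_join H) (Some x) (Some z) \<noteq> gdist (K1_join H) (Some y) (Some z)}"
    by (rule card_separators_without_apex[OF assms(1,3)])
  also have "\<dots> \<le> card (Some -` B)"
  proof (rule card_mono)
    show "finite (Some -` B)"
      using vimage_Some_generator_subset[OF assms(3)]
      by (rule finite_subset) (use assms(1) in \<open>simp add: pair_graph_iff\<close>)
  qed auto
  finally show ?thesis .
qed

text \<open>If some basis contains the apex, then \<open>B\<close> may be chosen to contain it; otherwise
  \<open>basis_apex\<close> vanishes and there is nothing to gain.\<close>

lemma basis_minus_apex:
  assumes "pair_graph H" and "metric_generator k (K1_join H) S"
  obtains B where "metric_generator k (K1_join H) B"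
    and "card (Some -` B) + basis_apex H k \<le> metric_dim k (K1_join H)"
proof -
  have "\<exists>B. metric_basis k (K1_join H) B \<and> (basis_apex H k = 1 \<longrightarrow> None \<in> B)"
  proof (cases "\<exists>B. metric_basis k (K1_join H) B \<and> None \<in> B")
    case True
    then show ?thesis
      by blast
  next
    case False
    then have "basis_apex H k = 0"
      by (simp add: basis_apex_def)
    then show ?thesis
      using metric_basis_exists[OF assms(2)] by auto
  qed
  then obtain B where B: "metric_basis k (K1_join H) B" and apex: "basis_apex H k = 1 \<Longrightarrow> None \<in> B"
    by blast
  then have gen: "metric_generator k (K1_join H) B"
    by (simp add: metric_basis_def)
  then have "B \<subseteq> pverts (K1_join H)"
    by (simp add: metric_generator_def)
  then have "finite B"
    by (rule finite_subset) (use pair_graph_K1_join[OF assms(1)] in \<open>simp add: pair_graph_iff\<close>)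
  have img: "Some ` (Some -` B) = B - {None}"
    by (auto simp: image_iff not_None_eq)
  have "card (Some -` B) = card (B - {None})"
    using card_image[of Some "Some -` B"] by (simp only: img inj_Some)
  moreover have "card (B - {None}) + basis_apex H k \<le> card B"
  proof (cases "basis_apex H k = 1")
    case True
    then show ?thesis
      using apex card_Suc_Diff1[OF \<open>finite B\<close>, of None] by simp
  next
    case False
    then have "basis_apex H k = 0"
      by (metis basis_apex_def)
    then show ?thesis
      using \<open>finite B\<close> by (simp add: card_mono)
  qed
  ultimately show thesis
    using that gen metric_dim_eq_card[OF B] by simp
qed

section \<open>Distances in corona products\<close>

context
  fixes G :: "'a pair_pre_digraph" and H :: "'a \<Rightarrow> 'b pair_pre_digraph"
  assumes G: "pair_graph G" and conn: "connected (with_proj G)"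
    and H: "\<And>v. v \<in> pverts G \<Longrightarrow> pair_graph (H v)"
begin

interpretation C: pair_graph "corona G H"
  using G H by (rule pair_graph_corona)

lemma gdist_corona_copy:
  assumes "v \<in> pverts G" and "x \<in> pverts (H v)" and "y \<in> pverts (H v)"
  shows "gdist (corona G H) (Inr (v, x)) (Inr (v, y)) = gdist (K1_join (H v)) (Some x) (Some y)"
proof -
  have "(Inr (v, x), Inl v) \<in> parcs (corona G H)" "(Inl v, Inr (v, y)) \<in> parcs (corona G H)"
    using assms by (auto simp: corona_def)
  moreover have "(Inr (v, x), Inr (v, y)) \<in> parcs (corona G H) \<longleftrightarrow> (x, y) \<in> parcs (H v)"
    using assms by (auto simp: corona_def)
  ultimately show ?thesis
    using assms H by (simp add: C.gdist_common_neighbour gdist_K1_join)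
qed

lemma gdist_corona_copy_le:
  assumes "v \<in> pverts G" and "x \<in> pverts (H v)" and "y \<in> pverts (H v)"
  shows "gdist (corona G H) (Inr (v, x)) (Inr (v, y)) \<le> 2"
  using assms H by (simp add: gdist_corona_copy gdist_K1_join)

lemma gdist_corona_apex:
  assumes "v \<in> pverts G" and "x \<in> pverts (H v)"
  shows "gdist (corona G H) (Inl v) (Inr (v, x)) = 1"
  using assms by (intro C.gdist_arc) (auto simp: corona_def)

lemma gdist_corona_other_apex_ge:
  assumes "u \<noteq> v"
  shows "2 \<le> gdist (corona G H) (Inl v) (Inr (u, y))"
  using assms by (intro C.gdist_nonadjacent_ge) (auto simp: corona_def)

lemma corona_reachable:
  assumes "v \<in> pverts G" and "x \<in> pverts (H v)" and "u \<in> pverts G" and "y \<in> pverts (H u)"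
  shows "Inr (v, x) \<rightarrow>\<^sup>*\<^bsub>with_proj (corona G H)\<^esub> Inr (u, y)"
proof -
  interpret G: pair_graph G by (fact G)
  have "strongly_connected (with_proj G)"
    using G.sym_arcs conn by (rule G.symmetric_connected_imp_strongly_connected)
  then have "v \<rightarrow>\<^sup>*\<^bsub>with_proj G\<^esub> u"
    using assms(1,3) by (simp add: strongly_connected_def)
  then have "Inl v \<rightarrow>\<^sup>*\<^bsub>with_proj (corona G H)\<^esub> Inl u"
  proof (induction rule: G.reachable_induct)
    case base
    then show ?case
      by (intro C.reachable_refl) (simp add: corona_def)
  next
    case (step a b)
    then have "(Inl a, Inl b) \<in> parcs (corona G H)"
      by (simp add: corona_def)
    with step show ?case
      using C.reachable_adj_trans by simp
  qed
  moreover have "(Inr (v, x), Inl v) \<in> parcs (corona G H)" "(Inl u, Inr (u, y)) \<in> parcs (corona G H)"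
    using assms by (auto simp: corona_def)
  ultimately show ?thesis
    using C.adj_reachable_trans C.reachable_adj_trans by simp
qed

text \<open>The gate of the copy of \<open>H v\<close> is \<open>v\<close>.\<close>

lemma gdist_corona_gate_less:
  assumes "v \<in> pverts G" and "x \<in> pverts (H v)" and "u \<in> pverts G" and "y \<in> pverts (H u)"
    and "u \<noteq> v"
  shows "gdist (corona G H) (Inl v) (Inr (u, y)) < gdist (corona G H) (Inr (v, x)) (Inr (u, y))"
proof (rule C.gdist_gate_less[where B = "Inr ` ({v} \<times> UNIV)"])
  show "Inr (v, x) \<rightarrow>\<^sup>*\<^bsub>with_proj (corona G H)\<^esub> Inr (u, y)"
    using assms by (simp add: corona_reachable)
qed (use assms in \<open>auto simp: corona_def\<close>)

text \<open>If the first vertex is copied and the second is not, the block of \<open>u\<close> may fail to separate them: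
  both can be at distance 2 from it when \<open>u\<close> and \<open>v\<close> are adjacent.  Exchanging the two
  vertices turns this excluded case into a covered one.\<close>

lemma corona_separated_by_block:
  assumes p: "p = Inl u \<or> p = Inr (u, x) \<and> x \<in> pverts (H u)"
    and q: "q = Inl v \<or> q = Inr (v, y) \<and> y \<in> pverts (H v)"
    and "p = Inl u \<or> q \<noteq> Inl v"
    and "u \<in> pverts G" and "v \<in> pverts G" and "u \<noteq> v" and "z \<in> pverts (H u)"
  shows "gdist (corona G H) p (Inr (u, z)) < gdist (corona G H) q (Inr (u, z))"
proof -
  have v2: "2 \<le> gdist (corona G H) (Inl v) (Inr (u, z))"
    using \<open>u \<noteq> v\<close> by (rule gdist_corona_other_apex_ge)
  show ?thesis
  proof (cases "q = Inl v")
    case True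
    with assms(3) have "gdist (corona G H) p (Inr (u, z)) = 1"
      using gdist_corona_apex assms(4,7) by simp
    then show ?thesis
      using v2 True by (auto intro: less_le_trans[of _ 2])
  next
    case False
    have "gdist (corona G H) p (Inr (u, z)) \<le> 2"
      using p gdist_corona_apex gdist_corona_copy_le assms(4,7) by auto
    also note v2
    also have "gdist (corona G H) (Inl v) (Inr (u, z)) < gdist (corona G H) q (Inr (u, z))"
      using q False gdist_corona_gate_less assms(4-7) by auto
    finally show ?thesis .
  qed
qed

section \<open>The generator of the corona product\<close>

lemma metric_generator_corona:
  assumes order: "2 \<le> card (pverts G)"
    and nontriv: "\<And>v. v \<in> pverts G \<Longrightarrow> 2 \<le> card (pverts (H v))"
    and gen: "\<And>v. v \<in> pverts G \<Longrightarrow> metric_generator k (K1_join (H v)) (B v)"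
  shows "metric_generator k (corona G H) (Inr ` (SIGMA v:pverts G. Some -` B v))"
    (is "metric_generator k _ ?S")
proof -
  let ?d = "gdist (corona G H)"
  have B: "z \<in> pverts (H v)" if "v \<in> pverts G" "Some z \<in> B v" for v z
    using vimage_Some_generator_subset[OF gen] that by blast
  have sub: "?S \<subseteq> pverts (corona G H)"
    using B by (auto simp: corona_def)
  then have fin: "finite ?S"
    using C.pair_finite_verts finite_subset by blast
  have count: "k \<le> card {w \<in> ?S. ?d p w \<noteq> ?d q w}"
    if "v \<in> pverts G" "Z \<subseteq> Some -` B v" "k \<le> card Z"
      and "\<And>z. z \<in> Z \<Longrightarrow> ?d p (Inr (v, z)) \<noteq> ?d q (Inr (v, z))" for p q v Z
  proof -
    have "card ((\<lambda>z. Inr (v, z)) ` Z :: ('a + 'a \<times> 'b) set) = card Z"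
      by (intro card_image) (auto intro: inj_onI)
    moreover have "(\<lambda>z. Inr (v, z)) ` Z \<subseteq> {w \<in> ?S. ?d p w \<noteq> ?d q w}"
      using that by auto
    then have "card ((\<lambda>z. Inr (v, z)) ` Z :: ('a + 'a \<times> 'b) set)
        \<le> card {w \<in> ?S. ?d p w \<noteq> ?d q w}"
      using fin by (intro card_mono) simp_all
    ultimately show ?thesis
      using that(3) by simp
  qed
  have sep_sym: "k \<le> card {w \<in> ?S. ?d q w \<noteq> ?d p w}"
    if "k \<le> card {w \<in> ?S. ?d p w \<noteq> ?d q w}" for p q
    using that by (simp only: neq_commute)
  have block: "k \<le> card {w \<in> ?S. ?d p w \<noteq> ?d q w}"
    if u: "u \<in> pverts G"
      and less: "\<And>z. z \<in> pverts (H u) \<Longrightarrow> ?d p (Inr (u, z)) < ?d q (Inr (u, z))" for p q u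
  proof (rule count[OF u order.refl])
    show "k \<le> card (Some -` B u)"
      using card_generator_without_apex[OF H[OF u] nontriv[OF u] gen[OF u]] .
    show "?d p (Inr (u, z)) \<noteq> ?d q (Inr (u, z))" if "z \<in> Some -` B u" for z
      using less[of z] B[OF u, of z] that by force
  qed
  have copy: "k \<le> card {w \<in> ?S. ?d (Inr (v, x)) w \<noteq> ?d (Inr (v, y)) w}"
    if v: "v \<in> pverts G" and x: "x \<in> pverts (H v)" and y: "y \<in> pverts (H v)" and "x \<noteq> y" for v x y
  proof (rule count[OF v])
    let ?Z = "{z \<in> Some -` B v. gdist (K1_join (H v)) (Some x) (Some z)
      \<noteq> gdist (K1_join (H v)) (Some y) (Some z)}"
    show "?Z \<subseteq> Some -` B v"
      by blast
    show "k \<le> card ?Z"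
      using card_separators_without_apex[OF H[OF v] gen[OF v] x y \<open>x \<noteq> y\<close>] .
    show "?d (Inr (v, x)) (Inr (v, z)) \<noteq> ?d (Inr (v, y)) (Inr (v, z))" if "z \<in> ?Z" for z
      using that v x y B by (auto simp: gdist_corona_copy)
  qed
  have apex: "k \<le> card {w \<in> ?S. ?d (Inl v) w \<noteq> ?d (Inr (v, x)) w}"
    if v: "v \<in> pverts G" and x: "x \<in> pverts (H v)" for v x
  proof -
    obtain u where u: "u \<in> pverts G" "u \<noteq> v"
      using order by (auto simp: numeral_2_eq_2 card_le_Suc_iff)
    show ?thesis
      by (rule block[OF u(1)]) (rule gdist_corona_gate_less[OF v x u(1) _ u(2)])
  qed
  have blocks: "k \<le> card {w \<in> ?S. ?d p w \<noteq> ?d q w}"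
    if p: "p = Inl u \<or> p = Inr (u, x) \<and> x \<in> pverts (H u)"
      and q: "q = Inl v \<or> q = Inr (v, y) \<and> y \<in> pverts (H v)"
      and uv: "u \<in> pverts G" "v \<in> pverts G" "u \<noteq> v" for p q u v x y
  proof (cases "p = Inl u \<or> q \<noteq> Inl v")
    case True
    show ?thesis
      by (rule block[OF uv(1)]) (rule corona_separated_by_block[OF p q True uv])
  next
    case False
    then have swapped: "q = Inl v \<or> p \<noteq> Inl u"
      by blast
    show ?thesis
      by (rule sep_sym, rule block[OF uv(2)])
        (rule corona_separated_by_block[OF q p swapped uv(2,1) uv(3)[symmetric]])
  qed
  have "k \<le> card {w \<in> ?S. ?d p w \<noteq> ?d q w}"
    if "p \<in> pverts (corona G H)" "q \<in> pverts (corona G H)" "p \<noteq> q" for p q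
  proof -
    obtain u x where p: "u \<in> pverts G" "p = Inl u \<or> p = Inr (u, x) \<and> x \<in> pverts (H u)"
      using \<open>p \<in> _\<close> by (auto simp: corona_def)
    obtain v y where q: "v \<in> pverts G" "q = Inl v \<or> q = Inr (v, y) \<and> y \<in> pverts (H v)"
      using \<open>q \<in> _\<close> by (auto simp: corona_def)
    show ?thesis
    proof (cases "u = v")
      case True
      from True p q \<open>p \<noteq> q\<close> consider
        "p = Inr (v, x)" "q = Inr (v, y)" "x \<in> pverts (H v)" "y \<in> pverts (H v)" "x \<noteq> y"
        | "p = Inl v" "q = Inr (v, y)" "y \<in> pverts (H v)"
        | "q = Inl v" "p = Inr (v, x)" "x \<in> pverts (H v)"
        by auto
      then show ?thesis
      proof cases
        case 1
        then show ?thesis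
          using copy[OF q(1), of x y] by simp
      next
        case 2
        then show ?thesis
          using apex[OF q(1), of y] by simp
      next
        case 3
        show ?thesis
          unfolding 3(1,2) by (rule sep_sym, rule apex[OF q(1) 3(3)])
      qed
    next
      case False
      show ?thesis
        by (rule blocks[OF p(2) q(2) p(1) q(1) False])
    qed
  qed
  with sub show ?thesis
    unfolding metric_generator_def by (intro conjI ballI impI)
qed

end

theorem theorem32:
  fixes G :: "'a pair_pre_digraph"
    and H :: "'a \<Rightarrow> 'b pair_pre_digraph"
    and \<kappa> :: "'a \<Rightarrow> nat"
    and k k' :: nat
  assumes "pair_graph G" and "connected (with_proj G)" and "card (pverts G) \<ge> 2"
    and "\<And>v. v \<in> pverts G \<Longrightarrow> pair_graph (H v)"
    and "\<And>v. v \<in> pverts G \<Longrightarrow> card (pverts (H v)) \<ge> 2"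
    and "\<And>v. v \<in> pverts G \<Longrightarrow> metric_dimensional (\<kappa> v) (K1_join (H v))"
    and "k' = Min (\<kappa> ` pverts G)"
    and "k \<in> {1..k'}"
  shows "int (metric_dim k (corona G H))
    \<le> (\<Sum>v\<in>pverts G. int (metric_dim k (K1_join (H v))) - int (basis_apex (H v) k))"
proof -
  have fin: "finite (pverts G)"
    using assms(1) by (simp add: pair_graph_iff)
  have "\<exists>B. metric_generator k (K1_join (H v)) B \<and>
      card (Some -` B) + basis_apex (H v) k \<le> metric_dim k (K1_join (H v))"
    if v: "v \<in> pverts G" for v
  proof -
    have "k \<le> \<kappa> v"
      using assms(7,8) fin v by (auto intro: order.trans)
    moreover obtain S where "metric_generator (\<kappa> v) (K1_join (H v)) S"
      using assms(6)[OF v] by (auto simp: metric_dimensional_def metric_basis_def)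
    ultimately show ?thesis
      using basis_minus_apex[OF assms(4)[OF v]] metric_generator_antimono by metis
  qed
  then obtain B where gen: "metric_generator k (K1_join (H v)) (B v)"
    and le: "card (Some -` B v) + basis_apex (H v) k \<le> metric_dim k (K1_join (H v))"
    if "v \<in> pverts G" for v
    by metis
  have finB: "finite (Some -` B v)" if "v \<in> pverts G" for v
    using vimage_Some_generator_subset[OF gen[OF that]]
    by (rule finite_subset) (use assms(4)[OF that] in \<open>simp add: pair_graph_iff\<close>)
  have "metric_dim k (corona G H) \<le> card (Inr ` (SIGMA v:pverts G. Some -` B v) :: ('a + 'a \<times> 'b) set)"
    using assms gen by (intro metric_dim_le_card metric_generator_corona) auto
  also have "\<dots> = (\<Sum>v\<in>pverts G. card (Some -` B v))"
    using fin finB by (simp add: card_image)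
  finally have "int (metric_dim k (corona G H)) \<le> (\<Sum>v\<in>pverts G. int (card (Some -` B v)))"
    by (metis of_nat_le_iff of_nat_sum)
  also have "\<dots> \<le> (\<Sum>v\<in>pverts G. int (metric_dim k (K1_join (H v))) - int (basis_apex (H v) k))"
  proof (rule sum_mono)
    fix v
    assume "v \<in> pverts G"
    from le[OF this]
    show "int (card (Some -` B v)) \<le> int (metric_dim k (K1_join (H v))) - int (basis_apex (H v) k)"
      by linarith
  qed
  finally show ?thesis .
qed

end
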